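(* The permutations $213$ and $2431$ form an annihilator pair: for every permutation $\tau$ and every pair of distinct indices $i,j\le|\tau|$, the permutation $\tau_{i,j}[213,2431]$ satisfies $\mu[1,\tau_{i,j}[213,2431]]=0$.
   Context: Permutations are ordered by containment: $\sigma\le\pi$ if $\pi$ has a subsequence order-isomorphic to $\sigma$. The Möbius function: $\mu[\sigma,\pi]=0$ if $\sigma\not\le\pi$, $\mu[\sigma,\pi]=1$ if $\sigma=\pi$, and $\mu[\sigma,\pi]=-\sum_{\sigma\le\tau<\pi}\mu[\sigma,\tau]$ otherwise; $1$ is the permutation of length one. For a permutation $\tau$ of length $m$, distinct indices $i,j\le m$ and non-empty permutations $\phi,\psi$, the inflation $\tau_{i,j}[\phi,\psi]$ is the permutation obtained from $\tau$ by replacing the entry $\tau_i$ by a block of $|\phi|$ consecutive positions whose values form a set of consecutive integers and are order-isomorphic to $\phi$, replacing $\tau_j$ likewise by a block order-isomorphic to $\psi$, and keeping every other entry as a single entry, so that the relative order between different blocks/entries is that of the corresponding entries of $\tau$. *)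

theory Defs
  imports "HOL-Combinatorics.Multiset_Permutations" "HOL-Library.Sublist"
begin

section \<open>Permutations and containment\<close>

text \<open>A permutation of length \<open>n\<close> is a list in one-line notation with entries \<open>1, \<dots>, n\<close>; list
  positions are counted from \<open>0\<close>. The empty list is the permutation of length zero.\<close>

definition is_perm :: "nat list \<Rightarrow> bool" where
  "is_perm xs \<longleftrightarrow> xs \<in> permutations_of_set {1..length xs}"

definition order_iso :: "nat list \<Rightarrow> nat list \<Rightarrow> bool" where
  "order_iso xs ys \<longleftrightarrow> length xs = length ys \<and>
     (\<forall>i<length xs. \<forall>j<length xs. xs ! i < xs ! j \<longleftrightarrow> ys ! i < ys ! j)"

definition contained :: "nat list \<Rightarrow> nat list \<Rightarrow> bool" where
  "contained \<sigma> \<pi> \<longleftrightarrow> (\<exists>ys. subseq ys \<pi> \<and> order_iso \<sigma> ys)"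

lemma is_permD:
  assumes "is_perm xs"
  shows "set xs = {1..length xs}" "distinct xs"
  using assms by (auto simp: is_perm_def permutations_of_set_def)

lemma is_permI: "set xs = {1..length xs} \<Longrightarrow> distinct xs \<Longrightarrow> is_perm xs"
  by (auto simp: is_perm_def permutations_of_set_def)

lemma is_perm_nth_rank:
  assumes "is_perm xs" "i < length xs"
  shows "xs ! i = Suc (card {k. k < length xs \<and> xs ! k < xs ! i})"
proof -
  let ?K = "{k. k < length xs \<and> xs ! k < xs ! i}"
  note p = is_permD[OF assms(1)]
  have inj: "inj_on ((!) xs) ?K"
    using p(2) by (auto simp: inj_on_def nth_eq_iff_index_eq)
  have i_in: "xs ! i \<in> {1..length xs}"
    using p(1) assms(2) nth_mem by blast
  have "(!) xs ` ?K = {v \<in> set xs. v < xs ! i}"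
    by (auto simp: in_set_conv_nth)
  also have "\<dots> = {1..<xs ! i}"
    using i_in by (auto simp: p(1))
  finally have "card ?K = card {1..<xs ! i}"
    using card_image[OF inj] by simp
  thus ?thesis using i_in by simp
qed

lemma order_iso_is_perm_eq:
  assumes "is_perm xs" "is_perm ys" "order_iso xs ys"
  shows "xs = ys"
proof (rule nth_equalityI)
  show len: "length xs = length ys" using assms(3) by (simp add: order_iso_def)
  fix i assume i: "i < length xs"
  have "{k. k < length xs \<and> xs ! k < xs ! i} = {k. k < length ys \<and> ys ! k < ys ! i}"
    using assms(3) i by (auto simp: order_iso_def)
  thus "xs ! i = ys ! i"
    using is_perm_nth_rank[OF assms(1) i] is_perm_nth_rank[OF assms(2)] i len by simp
qed

lemma contained_length_le: "contained \<sigma> \<pi> \<Longrightarrow> length \<sigma> \<le> length \<pi>"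
  by (auto simp: contained_def order_iso_def dest: list_emb_length)

lemma contained_neq_length_less:
  assumes "is_perm \<sigma>" "is_perm \<pi>" "contained \<sigma> \<pi>" "\<sigma> \<noteq> \<pi>"
  shows "length \<sigma> < length \<pi>"
proof (rule ccontr)
  assume "\<not> length \<sigma> < length \<pi>"
  then have len: "length \<sigma> = length \<pi>" using contained_length_le[OF assms(3)] by simp
  from assms(3) obtain ys where ys: "subseq ys \<pi>" "order_iso \<sigma> ys"
    by (auto simp: contained_def)
  have "ys = \<pi>"
    using ys len by (auto simp: order_iso_def dest: subseq_same_length)
  thus False using order_iso_is_perm_eq assms ys by blast
qed

section \<open>The Moebius function of the containment order\<close>

text \<open>Outside the permutations the function is set to \<open>0\<close>; this only serves to make it total on lists.\<close>

function mu :: "nat list \<Rightarrow> nat list \<Rightarrow> int" where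
  "mu \<sigma> \<pi> =
     (if \<not> (is_perm \<sigma> \<and> is_perm \<pi> \<and> contained \<sigma> \<pi>) then 0
      else if \<sigma> = \<pi> then 1
      else - (\<Sum>\<tau> \<in> {\<tau>. is_perm \<tau> \<and> contained \<sigma> \<tau> \<and> contained \<tau> \<pi> \<and> \<tau> \<noteq> \<pi>}. mu \<sigma> \<tau>))"
  by pat_completeness auto
termination
  by (relation "measure (\<lambda>(\<sigma>, \<pi>). length \<pi>)") (auto intro: contained_neq_length_less)

declare mu.simps [simp del]

text \<open>The sum above is over a finite set.\<close>

lemma finite_contained: "finite {\<tau>. is_perm \<tau> \<and> contained \<tau> \<pi>}"
proof (rule finite_subset)
  show "{\<tau>. is_perm \<tau> \<and> contained \<tau> \<pi>}
      \<subseteq> {xs. set xs \<subseteq> {1..length \<pi>} \<and> length xs \<le> length \<pi>}"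
    using is_permD(1) contained_length_le by fastforce
qed (rule finite_lists_length_le, simp)

section \<open>Inflation\<close>

text \<open>The entry of \<open>\<tau>\<close> at position \<open>k\<close> is replaced by the block \<open>B k\<close>, shifted up by the total
  size of the blocks replacing smaller entries of \<open>\<tau>\<close>.\<close>

definition block_offset :: "nat list \<Rightarrow> (nat \<Rightarrow> nat list) \<Rightarrow> nat \<Rightarrow> nat" where
  "block_offset \<tau> B k = (\<Sum>l | l < length \<tau> \<and> \<tau> ! l < \<tau> ! k. length (B l))"

definition inflation :: "nat list \<Rightarrow> (nat \<Rightarrow> nat list) \<Rightarrow> nat list" where
  "inflation \<tau> B = concat (map (\<lambda>k. map (\<lambda>v. block_offset \<tau> B k + v) (B k)) [0..<length \<tau>])"

definition inflation2 :: "nat list \<Rightarrow> nat \<Rightarrow> nat \<Rightarrow> nat list \<Rightarrow> nat list \<Rightarrow> nat list" where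
  "inflation2 \<tau> i j \<phi> \<psi> = inflation \<tau> (\<lambda>k. if k = i then \<phi> else if k = j then \<psi> else [1])"

lemma block_offset_less:
  assumes "k < length \<tau>" "\<tau> ! k < \<tau> ! l"
  shows "block_offset \<tau> B k + length (B k) \<le> block_offset \<tau> B l"
proof -
  let ?S = "\<lambda>k. {l. l < length \<tau> \<and> \<tau> ! l < \<tau> ! k}"
  have "block_offset \<tau> B k + length (B k) = (\<Sum>l \<in> insert k (?S k). length (B l))"
    by (simp add: block_offset_def)
  also have "\<dots> \<le> (\<Sum>l \<in> ?S l. length (B l))"
    by (rule sum_mono2) (use assms in auto)
  finally show ?thesis by (simp add: block_offset_def)
qed

lemma length_inflation: "length (inflation \<tau> B) = (\<Sum>k<length \<tau>. length (B k))"
  by (simp add: inflation_def length_concat o_def sum_list_sum_nth atLeast0LessThan)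

lemma set_inflation:
  "set (inflation \<tau> B) = (\<Union>k<length \<tau>. (\<lambda>v. block_offset \<tau> B k + v) ` set (B k))"
  by (auto simp: inflation_def)

lemma is_perm_inflation:
  assumes \<tau>: "is_perm \<tau>" and B: "\<And>k. k < length \<tau> \<Longrightarrow> is_perm (B k)"
  shows "is_perm (inflation \<tau> B)"
proof -
  let ?o = "block_offset \<tau> B"
  let ?b = "\<lambda>k. (\<lambda>v. ?o k + v) ` set (B k)"
  have setB: "set (B k) = {1..length (B k)}" if "k < length \<tau>" for k
    using is_permD(1)[OF B[OF that]] .
  have disj: "?b k \<inter> ?b l = {}" if "k < length \<tau>" "l < length \<tau>" "k \<noteq> l" for k l
  proof -
    have "\<tau> ! k < \<tau> ! l \<or> \<tau> ! l < \<tau> ! k"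
      using is_permD(2)[OF \<tau>] that by (auto simp: nth_eq_iff_index_eq neq_iff[symmetric])
    then show ?thesis
    proof
      assume "\<tau> ! k < \<tau> ! l"
      from block_offset_less[OF that(1) this, of B] show ?thesis
        using that by (auto simp: setB)
    next
      assume "\<tau> ! l < \<tau> ! k"
      from block_offset_less[OF that(2) this, of B] show ?thesis
        using that by (auto simp: setB)
    qed
  qed
  have "card (set (inflation \<tau> B)) = (\<Sum>k<length \<tau>. card (?b k))"
    unfolding set_inflation by (rule card_UN_disjoint) (use disj in auto)
  also have "\<dots> = (\<Sum>k<length \<tau>. length (B k))"
    by (rule sum.cong) (auto simp: card_image setB)
  finally have card: "card (set (inflation \<tau> B)) = length (inflation \<tau> B)"
    by (simp add: length_inflation)
  have "?o k + length (B k) \<le> length (inflation \<tau> B)" if "k < length \<tau>" for k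
  proof -
    have "?o k + length (B k)
        = (\<Sum>l \<in> insert k {l. l < length \<tau> \<and> \<tau> ! l < \<tau> ! k}. length (B l))"
      by (simp add: block_offset_def)
    also have "\<dots> \<le> (\<Sum>l<length \<tau>. length (B l))"
      by (rule sum_mono2) (use that in auto)
    finally show ?thesis by (simp add: length_inflation)
  qed
  then have "set (inflation \<tau> B) \<subseteq> {1..length (inflation \<tau> B)}"
    unfolding set_inflation by (force simp: setB)
  then have "set (inflation \<tau> B) = {1..length (inflation \<tau> B)}"
    by (rule card_subset_eq[rotated]) (simp_all add: card)
  then show ?thesis
    using card by (intro is_permI card_distinct)
qed

section \<open>Annihilator pairs\<close>

definition annihilator_pair :: "nat list \<Rightarrow> nat list \<Rightarrow> bool" where
  "annihilator_pair \<phi> \<psi> \<longleftrightarrow>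
     is_perm \<phi> \<and> \<phi> \<noteq> [] \<and> is_perm \<psi> \<and> \<psi> \<noteq> [] \<and>
     (\<forall>\<tau> i j. is_perm \<tau> \<and> i < length \<tau> \<and> j < length \<tau> \<and> i \<noteq> j \<longrightarrow>
        mu [1] (inflation2 \<tau> i j \<phi> \<psi>) = 0)"

end

theory Submission
  imports Defs
begin

text \<open>
  Let \<open>\<pi>\<close> have disjoint interval copies of \<open>\<phi>\<close> and \<open>\<psi>\<close>, and give the permutation
  obtained from \<open>\<pi>\<close> by shrinking these intervals to nonempty patterns \<open>a \<le> \<phi>\<close> and
  \<open>b \<le> \<psi>\<close> the weight \<open>\<mu>[a, \<phi>] \<mu>[b, \<psi>]\<close>. Since \<open>\<mu>[1, \<cdot>]\<close> sums to zero
  below each of these permutations, \<open>\<mu>[1, \<pi>] = 0\<close> follows once, for each \<open>\<rho> < \<pi>\<close>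
  with \<open>\<mu>[1, \<rho>] \<noteq> 0\<close>, the total weight of those that contain \<open>\<rho>\<close> is zero. If
  \<open>\<rho>\<close> embeds with a pattern \<open>a\<close> in one slot but has no interval copy of \<open>a\<close>, then it also
  embeds with a proper subpattern of \<open>a\<close> in that slot. This makes the weights cancel unless
  \<open>\<rho>\<close> has interval copies of certain pairs of patterns, and then \<open>\<mu>[1, \<rho>] = 0\<close> by
  induction on the length, if one treats in succession the pairs \<open>12, 21\<close>, then \<open>213, 321\<close>,
  then \<open>213, 2431\<close>. In each of these pairs, two interval copies are automatically disjoint.
\<close>

lemma order_iso_refl: "order_iso xs xs"
  by (simp add: order_iso_def)

lemma order_iso_sym: "order_iso xs ys \<Longrightarrow> order_iso ys xs"
  by (simp add: order_iso_def)

lemma order_iso_trans: "order_iso xs ys \<Longrightarrow> order_iso ys zs \<Longrightarrow> order_iso xs zs"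
  by (simp add: order_iso_def)

lemma order_iso_map:
  assumes "strict_mono_on (set xs) f"
  shows "order_iso xs (map f xs)"
proof -
  have "f x < f y \<longleftrightarrow> x < y" if "x \<in> set xs" "y \<in> set xs" for x y
    using assms that by (metis linorder_less_linear order_less_asym strict_mono_onD)
  then show ?thesis by (simp add: order_iso_def)
qed

lemma order_iso_mapE:
  assumes "order_iso xs ys"
  obtains f where "strict_mono_on (set xs) f" "ys = map f xs"
proof -
  have len: "length xs = length ys"
    and iso: "\<And>i j. i < length xs \<Longrightarrow> j < length xs \<Longrightarrow> xs ! i < xs ! j \<longleftrightarrow> ys ! i < ys ! j"
    using assms by (auto simp: order_iso_def)
  have "\<forall>v\<in>set xs. \<exists>i<length xs. xs ! i = v" by (simp add: in_set_conv_nth)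
  then obtain g where g: "\<And>v. v \<in> set xs \<Longrightarrow> g v < length xs \<and> xs ! g v = v" by metis
  define f where "f = (\<lambda>v. ys ! g v)"
  have "strict_mono_on (set xs) f"
    by (rule strict_mono_onI) (metis f_def g iso)
  moreover have "ys = map f xs"
  proof (rule nth_equalityI)
    fix i assume "i < length ys"
    then have i: "i < length xs" and gi: "g (xs ! i) < length xs" "xs ! g (xs ! i) = xs ! i"
      using len g by auto
    then have "\<not> ys ! i < ys ! g (xs ! i)" "\<not> ys ! g (xs ! i) < ys ! i"
      using iso by (metis less_irrefl)+
    then show "ys ! i = map f xs ! i" using i by (simp add: f_def)
  qed (simp add: len)
  ultimately show ?thesis by (rule that)
qed

lemma contained_order_iso:
  assumes "contained \<sigma> xs" "order_iso xs ys"
  shows "contained \<sigma> ys"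
proof -
  obtain f where f: "strict_mono_on (set xs) f" "ys = map f xs"
    using assms(2) by (rule order_iso_mapE)
  obtain zs where zs: "subseq zs xs" "order_iso \<sigma> zs"
    using assms(1) by (auto simp: contained_def)
  have "strict_mono_on (set zs) f"
    using f(1) zs(1) by (auto intro: monotone_on_subset dest: list_emb_set)
  then have "order_iso \<sigma> (map f zs)" using zs(2) order_iso_map order_iso_trans by blast
  then show ?thesis using f(2) zs(1) subseq_map by (auto simp: contained_def)
qed

lemma contained_mono: "contained \<sigma> xs \<Longrightarrow> subseq xs ys \<Longrightarrow> contained \<sigma> ys"
  unfolding contained_def using subseq_order.order_trans by blast

lemma standardization_exists:
  assumes "distinct xs"
  shows "\<exists>\<pi>. is_perm \<pi> \<and> order_iso xs \<pi>"
proof -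
  define f where "f v = card {x \<in> set xs. x \<le> v}" for v
  have mono: "strict_mono_on (set xs) f"
  proof (rule strict_mono_onI)
    fix r s assume rs: "r \<in> set xs" "s \<in> set xs" "r < s"
    then have "s \<in> {x \<in> set xs. x \<le> s} - {x \<in> set xs. x \<le> r}" by simp
    moreover have "{x \<in> set xs. x \<le> r} \<subseteq> {x \<in> set xs. x \<le> s}" using rs(3) by auto
    ultimately show "f r < f s"
      unfolding f_def by (intro psubset_card_mono) auto
  qed
  have inj: "inj_on f (set xs)"
    using mono by (rule strict_mono_on_imp_inj_on)
  have sub: "f ` set xs \<subseteq> {1..length xs}"
  proof
    fix k assume "k \<in> f ` set xs"
    then obtain v where v: "v \<in> set xs" "k = f v" by blast
    have "f v \<le> card (set xs)" unfolding f_def by (rule card_mono) auto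
    moreover have "0 < f v" unfolding f_def using v(1) by (auto simp: card_gt_0_iff)
    ultimately show "k \<in> {1..length xs}"
      using v(2) distinct_card[OF assms] by simp
  qed
  have "f ` set xs = {1..length xs}"
    by (rule card_subset_eq) (use sub assms inj in \<open>auto simp: card_image distinct_card\<close>)
  then have "is_perm (map f xs)"
    by (intro is_permI) (use assms inj in \<open>auto simp: distinct_map\<close>)
  then show ?thesis using order_iso_map[OF mono] by blast
qed

lemma sum_mu_contained_eq_0:
  assumes "distinct xs" "2 \<le> length xs"
  shows "(\<Sum>\<rho> | is_perm \<rho> \<and> contained \<rho> xs. mu [1] \<rho>) = 0"
proof -
  obtain \<pi> where \<pi>: "is_perm \<pi>" "order_iso xs \<pi>"
    using standardization_exists[OF assms(1)] by blast
  have eq: "contained \<rho> xs \<longleftrightarrow> contained \<rho> \<pi>" for \<rho>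
    using contained_order_iso \<pi>(2) order_iso_sym by blast
  have len: "2 \<le> length \<pi>" using \<pi>(2) assms(2) by (simp add: order_iso_def)
  let ?D = "{\<tau>. is_perm \<tau> \<and> contained \<tau> \<pi>}"
  have perm1: "is_perm [1]" by (rule is_permI) auto
  have "contained [1] \<pi>"
    unfolding contained_def
  proof (intro exI conjI)
    show "subseq [hd \<pi>] \<pi>" using len by (cases \<pi>) auto
    show "order_iso [1] [hd \<pi>]" by (simp add: order_iso_def)
  qed
  then have "mu [1] \<pi> =
      - (\<Sum>\<tau> | is_perm \<tau> \<and> contained [1] \<tau> \<and> contained \<tau> \<pi> \<and> \<tau> \<noteq> \<pi>. mu [1] \<tau>)"
    using perm1 \<pi>(1) len by (subst mu.simps) auto
  also have "(\<Sum>\<tau> | is_perm \<tau> \<and> contained [1] \<tau> \<and> contained \<tau> \<pi> \<and> \<tau> \<noteq> \<pi>. mu [1] \<tau>)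
      = (\<Sum>\<tau> \<in> ?D - {\<pi>}. mu [1] \<tau>)"
  proof (rule sum.mono_neutral_left)
    show "\<forall>\<tau> \<in> ?D - {\<pi>} - {\<tau>. is_perm \<tau> \<and> contained [1] \<tau> \<and> contained \<tau> \<pi> \<and> \<tau> \<noteq> \<pi>}. mu [1] \<tau> = 0"
      by (auto simp: mu.simps)
  qed (use finite_contained in auto)
  finally have "mu [1] \<pi> + (\<Sum>\<tau> \<in> ?D - {\<pi>}. mu [1] \<tau>) = 0" by simp
  moreover have "\<pi> \<in> ?D"
    using \<pi>(1) order_iso_refl by (auto simp: contained_def)
  ultimately show ?thesis
    using sum.remove[OF finite_contained, of \<pi> \<pi> "mu [1]"] by (simp add: eq)
qed

definition block_in :: "nat list \<Rightarrow> nat list \<Rightarrow> nat list \<Rightarrow> bool" where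
  "block_in s m t \<longleftrightarrow>
     (\<forall>x \<in> set s \<union> set t. (\<forall>y\<in>set m. x < y) \<or> (\<forall>y\<in>set m. y < x))"

definition interval_copy :: "nat list \<Rightarrow> nat list \<Rightarrow> bool" where
  "interval_copy \<phi> xs \<longleftrightarrow> (\<exists>s m t. xs = s @ m @ t \<and> order_iso \<phi> m \<and> block_in s m t)"

lemma block_in_subset:
  assumes "block_in s m t" "set s' \<subseteq> set s" "set m' \<subseteq> set m" "set t' \<subseteq> set t"
  shows "block_in s' m' t'"
  using assms unfolding block_in_def by blast

lemma block_in_subseq:
  assumes "block_in s m t" "subseq s' s" "subseq m' m" "subseq t' t"
  shows "block_in s' m' t'"
  using assms by (intro block_in_subset[OF assms(1)]) (auto dest: list_emb_set)

lemma interval_copy_order_iso: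
  assumes "interval_copy \<phi> xs" "order_iso xs ys"
  shows "interval_copy \<phi> ys"
proof -
  obtain f where f: "strict_mono_on (set xs) f" "ys = map f xs"
    using assms(2) by (rule order_iso_mapE)
  obtain s m t where m: "xs = s @ m @ t" "order_iso \<phi> m" "block_in s m t"
    using assms(1) by (auto simp: interval_copy_def)
  have "strict_mono_on (set m) f"
    using f(1) m(1) by (auto intro: monotone_on_subset)
  then have "order_iso \<phi> (map f m)"
    using m(2) order_iso_map order_iso_trans by blast
  moreover have "block_in (map f s) (map f m) (map f t)"
    unfolding block_in_def
  proof
    fix x assume "x \<in> set (map f s) \<union> set (map f t)"
    then obtain x' where x: "x = f x'" "x' \<in> set s \<union> set t" by auto
    have lt: "f a < f b" if "a < b" "a \<in> set xs" "b \<in> set xs" for a b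
      using f(1) that by (simp add: strict_mono_onD)
    from m(3) x(2) have "(\<forall>y\<in>set m. x' < y) \<or> (\<forall>y\<in>set m. y < x')"
      by (auto simp: block_in_def)
    then show "(\<forall>y\<in>set (map f m). x < y) \<or> (\<forall>y\<in>set (map f m). y < x)"
      using x lt m(1) by auto
  qed
  ultimately show ?thesis using f(2) m(1) by (auto simp: interval_copy_def)
qed

lemma interval_copy_cong: "interval_copy \<phi> xs \<Longrightarrow> order_iso \<psi> \<phi> \<Longrightarrow> interval_copy \<psi> xs"
  unfolding interval_copy_def using order_iso_trans by blast

lemma interval_copy_sub:
  assumes "interval_copy (a @ m @ b) xs" "block_in a m b"
  shows "interval_copy m xs"
proof -
  obtain s c t where c: "xs = s @ c @ t" "order_iso (a @ m @ b) c" "block_in s c t"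
    using assms(1) by (auto simp: interval_copy_def)
  have "interval_copy m c"
  proof (rule interval_copy_order_iso[OF _ c(2)])
    show "interval_copy m (a @ m @ b)"
      using assms(2) order_iso_refl unfolding interval_copy_def by blast
  qed
  then obtain a' m' b' where m': "c = a' @ m' @ b'" "order_iso m m'" "block_in a' m' b'"
    by (auto simp: interval_copy_def)
  have "block_in (s @ a') m' (b' @ t)"
    unfolding block_in_def
  proof
    fix x assume "x \<in> set (s @ a') \<union> set (b' @ t)"
    then consider "x \<in> set s \<union> set t" | "x \<in> set a' \<union> set b'" by auto
    then show "(\<forall>y\<in>set m'. x < y) \<or> (\<forall>y\<in>set m'. y < x)"
    proof cases
      case 1
      have "set m' \<subseteq> set c" unfolding m'(1) by auto
      then show ?thesis using c(3) 1 unfolding block_in_def by blast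
    next
      case 2
      then show ?thesis using m'(3) unfolding block_in_def by blast
    qed
  qed
  moreover have "xs = (s @ a') @ m' @ (b' @ t)" using c(1) m'(1) by simp
  ultimately show ?thesis
    using m'(2) unfolding interval_copy_def
    by (intro exI[of _ "s @ a'"] exI[of _ m'] exI[of _ "b' @ t"] conjI)
qed

lemma order_iso_sub_block:
  assumes "block_in s m t" "set a \<subseteq> set m" "set b \<subseteq> set m" "order_iso a b"
  shows "order_iso (s @ a @ t) (s @ b @ t)"
proof -
  obtain f where f: "strict_mono_on (set a) f" "b = map f a"
    using assms(4) by (rule order_iso_mapE)
  have same: "(\<forall>y\<in>set a. x < y \<and> x < f y) \<or> (\<forall>y\<in>set a. y < x \<and> f y < x)"
    if "x \<in> set s \<union> set t" for x
  proof -
    have "(\<forall>y\<in>set m. x < y) \<or> (\<forall>y\<in>set m. y < x)"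
      using assms(1) that by (auto simp: block_in_def)
    moreover have "f y \<in> set m" if "y \<in> set a" for y using that assms(3) f(2) by auto
    ultimately show ?thesis using assms(2) by blast
  qed
  define g where "g v = (if v \<in> set a then f v else v)" for v
  have "strict_mono_on (set (s @ a @ t)) g"
  proof (rule strict_mono_onI)
    fix r v assume *: "r \<in> set (s @ a @ t)" "v \<in> set (s @ a @ t)" "r < v"
    consider "r \<in> set a" "v \<in> set a" | "r \<in> set a" "v \<in> set s \<union> set t" "v \<notin> set a"
      | "v \<in> set a" "r \<in> set s \<union> set t" "r \<notin> set a"
      | "v \<notin> set a" "r \<notin> set a" using *(1,2) by auto
    then show "g r < g v"
    proof cases
      case 1 then show ?thesis using f(1) *(3) by (simp add: g_def strict_mono_onD)
    next
      case 2
      then show ?thesis using same[of v] *(3) by (auto simp: g_def)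
    next
      case 3
      then show ?thesis using same[of r] *(3) by (auto simp: g_def)
    qed (use *(3) in \<open>simp add: g_def\<close>)
  qed
  then have "order_iso (s @ a @ t) (map g (s @ a @ t))" by (rule order_iso_map)
  moreover have "x \<notin> set a" if "x \<in> set s \<union> set t" for x
    using same[OF that] by blast
  then have "map g s = s" "map g t = t" "map g a = b"
    using f(2) by (auto simp: g_def map_idI)
  ultimately show ?thesis by simp
qed

primrec deletions :: "'a list \<Rightarrow> 'a list list" where
  "deletions [] = []"
| "deletions (x # xs) = xs # map ((#) x) (deletions xs)"

lemma subseq_deletions: "d \<in> set (deletions xs) \<Longrightarrow> subseq d xs"
  by (induction xs arbitrary: d) auto

lemma subseq_neq_imp_deletion:
  assumes "subseq ys xs" "ys \<noteq> xs"
  shows "\<exists>d\<in>set (deletions xs). subseq ys d"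
  using assms
proof (induction)
  case (list_emb_Nil ys)
  then show ?case by (cases ys) auto
qed auto

lemma contained_block_cases:
  assumes "contained \<rho> (s @ m @ t)" "block_in s m t"
  shows "interval_copy m \<rho> \<or> (\<exists>d\<in>set (deletions m). contained \<rho> (s @ d @ t))"
proof -
  obtain zs where zs: "subseq zs (s @ m @ t)" "order_iso \<rho> zs"
    using assms(1) by (auto simp: contained_def)
  then obtain s' m' t' where z: "zs = s' @ m' @ t'" "subseq s' s" "subseq m' m" "subseq t' t"
    by (metis subseq_append_iff)
  show ?thesis
  proof (cases "m' = m")
    case True
    have "block_in s' m t'"
      using block_in_subseq[OF assms(2)] z(2,4) by simp
    then have "interval_copy m zs"
      unfolding interval_copy_def using z(1) True order_iso_refl by blast
    then show ?thesis using interval_copy_order_iso order_iso_sym[OF zs(2)] by blast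
  next
    case False
    then obtain d where d: "d \<in> set (deletions m)" "subseq m' d"
      using subseq_neq_imp_deletion z(3) by blast
    then have "contained \<rho> (s @ d @ t)"
      unfolding contained_def z(1)[symmetric] using z(2,4) zs(2)
      by (metis z(1) list_emb_append_mono)
    then show ?thesis using d(1) by blast
  qed
qed

lemma order_iso_Nil: "order_iso [] ys \<longleftrightarrow> ys = []"
  by (auto simp: order_iso_def)

lemma order_iso_Cons:
  "order_iso (x # xs) zs \<longleftrightarrow> (\<exists>y ys. zs = y # ys \<and>
     order_iso xs ys \<and> list_all2 (\<lambda>u v. (x < u \<longleftrightarrow> y < v) \<and> (u < x \<longleftrightarrow> v < y)) xs ys)"
  by (cases zs) (auto simp: order_iso_def list_all2_conv_all_nth All_less_Suc2)

text \<open>Fixing the contents of either block leaves a word with one distinguished block, so that the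
  order in which the two blocks occur does not matter.\<close>

definition two_slots :: "(nat list \<Rightarrow> nat list \<Rightarrow> nat list) \<Rightarrow> nat list \<Rightarrow> nat list \<Rightarrow> bool" where
  "two_slots F m m' \<longleftrightarrow>
     (\<forall>b. subseq b m' \<longrightarrow> (\<exists>s t. (\<forall>a. F a b = s @ a @ t) \<and> block_in s m t)) \<and>
     (\<forall>a. subseq a m \<longrightarrow> (\<exists>s t. (\<forall>b. F a b = s @ b @ t) \<and> block_in s m' t))"

lemma two_slots_mono:
  assumes "two_slots F m m'" "subseq a m" "subseq b m'"
  shows "subseq (F a b) (F m m')"
proof -
  have "subseq (F a b) (F m b)"
    using assms unfolding two_slots_def by (metis subseq_append subseq_append')
  also have "subseq (F m b) (F m m')"
    using assms unfolding two_slots_def by (metis subseq_append subseq_append' subseq_order.refl)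
  finally show ?thesis .
qed

lemma two_slots_length:
  assumes "two_slots F m m'" "subseq a m" "subseq b m'"
  shows "length a + length b \<le> length (F a b)"
    "length a \<noteq> length m \<or> length b \<noteq> length m' \<Longrightarrow> length (F a b) < length (F m m')"
proof -
  obtain s t where 1: "\<And>a. F a b = s @ a @ t"
    using assms unfolding two_slots_def by blast
  obtain s' t' where 2: "\<And>b. F m b = s' @ b @ t'"
    using assms unfolding two_slots_def by blast
  obtain s2 t2 where 3: "\<And>b. F [] b = s2 @ b @ t2"
    using assms(1) unfolding two_slots_def by (meson list_emb_Nil)
  have "length b \<le> length s + length t"
    using 1[of "[]"] 3[of b] by (metis append_Nil length_append le_add1 add.commute add.left_commute)
  then show "length a + length b \<le> length (F a b)" by (simp add: 1)
  have "length (F m b) + length m' = length (F m m') + length b" by (simp add: 2)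
  moreover have "length (F a b) + length m = length (F m b) + length a" by (simp add: 1)
  moreover have "length a \<le> length m" "length b \<le> length m'"
    using assms(2,3) list_emb_length by blast+
  moreover assume "length a \<noteq> length m \<or> length b \<noteq> length m'"
  ultimately show "length (F a b) < length (F m m')" by linarith
qed

text \<open>The sum of \<open>mu [1] \<rho>\<close> over all \<open>\<rho>\<close> contained in \<open>F a b\<close> vanishes for all nonempty \<open>a\<close>,
  \<open>b\<close>. Exchange the two summations in the combination of these sums with product weights.\<close>

lemma mu_eq_0_by_weights:
  fixes as bs :: "(int \<times> nat list) list"
  assumes F: "two_slots F m m'" and perm: "is_perm (F m m')"
    and as: "\<And>c a. (c, a) \<in> set as \<Longrightarrow> subseq a m \<and> a \<noteq> m \<and> a \<noteq> []"
    and bs: "\<And>c b. (c, b) \<in> set bs \<Longrightarrow> subseq b m' \<and> b \<noteq> m' \<and> b \<noteq> []"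
    and ne: "m \<noteq> []" "m' \<noteq> []"
    and cancel: "\<And>\<rho>. is_perm \<rho> \<Longrightarrow> length \<rho> < length (F m m') \<Longrightarrow> mu [1] \<rho> \<noteq> 0 \<Longrightarrow>
      (\<forall>b. subseq b m' \<longrightarrow> (\<Sum>(c, a) \<leftarrow> (1, m) # as. c * of_bool (contained \<rho> (F a b))) = 0) \<or>
      (\<forall>a. subseq a m \<longrightarrow> (\<Sum>(c, b) \<leftarrow> (1, m') # bs. c * of_bool (contained \<rho> (F a b))) = 0)"
  shows "mu [1] (F m m') = 0"
proof -
  define \<pi> where "\<pi> = F m m'"
  define A B where "A = (1, m) # as" and "B = (1, m') # bs"
  let ?L = "{\<rho>. is_perm \<rho> \<and> contained \<rho> \<pi>}"
  have A: "subseq a m \<and> a \<noteq> []" if "(c, a) \<in> set A" for c a using that as ne by (auto simp: A_def)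
  have B: "subseq b m' \<and> b \<noteq> []" if "(c, b) \<in> set B" for c b using that bs ne by (auto simp: B_def)
  define C where "C \<rho> = (\<Sum>(c, a) \<leftarrow> A. c * (\<Sum>(d, b) \<leftarrow> B. d * of_bool (contained \<rho> (F a b))))" for \<rho>
  have H: "(\<Sum>\<rho>\<in>?L. mu [1] \<rho> * of_bool (contained \<rho> (F a b))) = 0"
    if "(c, a) \<in> set A" "(d, b) \<in> set B" for c a d b
  proof -
    have sub: "subseq (F a b) \<pi>"
      using two_slots_mono[OF F] A[OF that(1)] B[OF that(2)] by (simp add: \<pi>_def)
    have "{\<rho>. is_perm \<rho> \<and> contained \<rho> (F a b)} \<subseteq> ?L"
      using contained_mono[OF _ sub] by blast
    then have "(\<Sum>\<rho>\<in>?L. mu [1] \<rho> * of_bool (contained \<rho> (F a b)))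
        = (\<Sum>\<rho> | is_perm \<rho> \<and> contained \<rho> (F a b). mu [1] \<rho> * of_bool (contained \<rho> (F a b)))"
      by (intro sum.mono_neutral_right) (auto simp: finite_contained)
    also have "\<dots> = (\<Sum>\<rho> | is_perm \<rho> \<and> contained \<rho> (F a b). mu [1] \<rho>)"
      by (rule sum.cong) auto
    also have "\<dots> = 0"
    proof (rule sum_mu_contained_eq_0)
      show "distinct (F a b)"
        using sub is_permD(2)[OF perm] by (auto simp: \<pi>_def subseq_conv_nths)
      have "length a \<noteq> 0" "length b \<noteq> 0" using A B that by auto
      then show "2 \<le> length (F a b)"
        using two_slots_length(1)[OF F, of a b] A[OF that(1)] B[OF that(2)] by linarith
    qed
    finally show ?thesis .
  qed
  have swap: "(\<Sum>\<rho>\<in>?L. f \<rho> * (\<Sum>(c, a) \<leftarrow> xs. c * g a \<rho>)) = (\<Sum>(c, a) \<leftarrow> xs. c * (\<Sum>\<rho>\<in>?L. f \<rho> * g a \<rho>))"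
    for f and g :: "nat list \<Rightarrow> nat list \<Rightarrow> int" and xs
    by (induction xs) (auto simp: sum.distrib algebra_simps sum_distrib_left)
  have zero: "(\<Sum>(c, a) \<leftarrow> xs. c * h a) = 0" if "\<And>c a. (c, a) \<in> set xs \<Longrightarrow> h a = 0"
    for h :: "nat list \<Rightarrow> int" and xs
    using that
  proof (induction xs)
    case (Cons x xs)
    have "h (snd x) = 0" using Cons.prems[of "fst x" "snd x"] by simp
    moreover have "(\<Sum>(c, a) \<leftarrow> xs. c * h a) = 0" using Cons.prems by (intro Cons.IH) auto
    ultimately show ?case by (simp add: case_prod_unfold)
  qed simp
  have exch: "(\<Sum>(c, a) \<leftarrow> xs. c * (\<Sum>(d, b) \<leftarrow> ys. d * h a b)) = (\<Sum>(d, b) \<leftarrow> ys. d * (\<Sum>(c, a) \<leftarrow> xs. c * h a b))"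
    for h :: "nat list \<Rightarrow> nat list \<Rightarrow> int" and xs ys
  proof (induction xs)
    case Nil
    then show ?case by (induction ys) auto
  next
    case (Cons x xs)
    have "(\<Sum>(d, b) \<leftarrow> ys. d * (\<Sum>(c, a) \<leftarrow> x # xs. c * h a b)) =
       fst x * (\<Sum>(d, b) \<leftarrow> ys. d * h (snd x) b) +
       (\<Sum>(d, b) \<leftarrow> ys. d * (\<Sum>(c, a) \<leftarrow> xs. c * h a b))"
      by (induction ys) (auto simp: algebra_simps case_prod_unfold)
    then show ?case using Cons by (simp add: case_prod_unfold)
  qed
  have C0: "C \<rho> = 0" if "\<rho> \<in> ?L" "\<rho> \<noteq> \<pi>" "mu [1] \<rho> \<noteq> 0" for \<rho>
  proof -
    have "length \<rho> < length (F m m')"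
      using that perm contained_neq_length_less by (simp add: \<pi>_def)
    from cancel[OF _ this that(3)] that(1)
    consider "\<And>b. subseq b m' \<Longrightarrow> (\<Sum>(c, a) \<leftarrow> A. c * of_bool (contained \<rho> (F a b))) = (0::int)"
      | "\<And>a. subseq a m \<Longrightarrow> (\<Sum>(c, b) \<leftarrow> B. c * of_bool (contained \<rho> (F a b))) = (0::int)"
      unfolding A_def B_def by blast
    then show ?thesis
    proof cases
      case 1
      show ?thesis unfolding C_def by (subst exch, rule zero) (use 1 B in blast)
    next
      case 2
      show ?thesis unfolding C_def by (rule zero) (use 2 A in blast)
    qed
  qed
  have C\<pi>: "C \<pi> = 1"
  proof -
    have no: "\<not> contained \<pi> (F a b)"
      if "subseq a m" "subseq b m'" "a \<noteq> m \<or> b \<noteq> m'" for a b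
      using two_slots_length(2)[OF F that(1,2)] that contained_length_le[of \<pi> "F a b"]
        subseq_same_length by (fastforce simp: \<pi>_def)
    have yes: "contained \<pi> (F m m')"
      unfolding \<pi>_def contained_def using order_iso_refl by blast
    have "(\<Sum>(d, b) \<leftarrow> B. d * of_bool (contained \<pi> (F m b))) = (1::int)"
      unfolding B_def using yes no bs by (simp add: zero)
    moreover have "(\<Sum>(c, a) \<leftarrow> as. c * (\<Sum>(d, b) \<leftarrow> B. d * of_bool (contained \<pi> (F a b)))) = (0::int)"
      by (rule zero, rule zero) (use no as B in auto)
    ultimately show ?thesis unfolding C_def A_def by simp
  qed
  have "(\<Sum>\<rho>\<in>?L. mu [1] \<rho> * C \<rho>) = 0"
    unfolding C_def by (subst swap, rule zero, subst swap, rule zero) (use H in blast)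
  moreover have "(\<Sum>\<rho>\<in>?L. mu [1] \<rho> * C \<rho>) = (\<Sum>\<rho>\<in>{\<pi>}. mu [1] \<rho> * C \<rho>)"
  proof (rule sum.mono_neutral_right)
    have "contained \<pi> \<pi>" unfolding contained_def using order_iso_refl by blast
    then show "{\<pi>} \<subseteq> ?L" using perm by (simp add: \<pi>_def)
    show "\<forall>\<rho>\<in>?L - {\<pi>}. mu [1] \<rho> * C \<rho> = 0" using C0 by auto
  qed (rule finite_contained)
  ultimately show ?thesis using C\<pi> by (simp add: \<pi>_def)
qed

lemma two_slotsI:
  assumes "block_in s m (v @ m' @ t)" "block_in (s @ m @ v) m' t"
  shows "two_slots (\<lambda>a b. s @ a @ v @ b @ t) m m'"
    and "two_slots (\<lambda>b a. s @ a @ v @ b @ t) m' m"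
proof -
  have 1: "block_in s m (v @ b @ t)" if "subseq b m'" for b
    using list_emb_set[OF that] by (intro block_in_subset[OF assms(1)]) auto
  have 2: "block_in (s @ a @ v) m' t" if "subseq a m" for a
    using list_emb_set[OF that] by (intro block_in_subset[OF assms(2)]) auto
  have 3: "\<exists>s1 t1. (\<forall>a. s @ a @ v @ b @ t = s1 @ a @ t1) \<and> block_in s1 m t1" if "subseq b m'" for b
    using 1[OF that] by blast
  have 4: "\<exists>s1 t1. (\<forall>b. s @ a @ v @ b @ t = s1 @ b @ t1) \<and> block_in s1 m' t1" if "subseq a m" for a
    using 2[OF that] by (intro exI[of _ "s @ a @ v"] exI[of _ t]) simp
  show "two_slots (\<lambda>a b. s @ a @ v @ b @ t) m m'" "two_slots (\<lambda>b a. s @ a @ v @ b @ t) m' m"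
    unfolding two_slots_def using 3 4 by simp_all
qed

lemma two_slots_exist:
  assumes "xs = s @ m @ t" "block_in s m t" "xs = s' @ m' @ t'" "block_in s' m' t'"
    and "length s + length m \<le> length s' \<or> length s' + length m' \<le> length s"
  shows "\<exists>F. two_slots F m m' \<and> F m m' = xs"
proof -
  have split: "\<exists>v. s' = s @ m @ v \<and> t = v @ m' @ t'"
    if "s @ m @ t = s' @ m' @ t'" "length s + length m \<le> length s'"
    for s s' m m' t t' :: "nat list"
  proof -
    from that(1) have "(s @ m) @ t = s' @ (m' @ t')" by simp
    then show ?thesis using that(2) by (auto simp: append_eq_append_conv2)
  qed
  from assms(5) show ?thesis
  proof
    assume "length s + length m \<le> length s'"
    then obtain v where "s' = s @ m @ v" "t = v @ m' @ t'" using split assms(1,3) by metis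
    then show ?thesis using two_slotsI(1) assms by (intro exI[of _ "\<lambda>a b. s @ a @ v @ b @ t'"]) auto
  next
    assume "length s' + length m' \<le> length s"
    then obtain v where "s = s' @ m' @ v" "t' = v @ m @ t" using split assms(1,3) by metis
    then show ?thesis using two_slotsI(2) assms by (intro exI[of _ "\<lambda>b a. s' @ a @ v @ b @ t"]) auto
  qed
qed

lemma disjoint_interval_copies:
  assumes \<phi>: "interval_copy \<phi> xs" and \<psi>: "interval_copy \<psi> xs"
    and clash: "\<And>p q m m'. \<lbrakk>order_iso \<phi> m; order_iso \<psi> m'; q < p + length \<phi>; p < q + length \<psi>;
      \<forall>k<length \<phi>. \<forall>l<length \<psi>. p + k = q + l \<longrightarrow> m ! k = m' ! l;
      \<forall>l<length \<psi>. q + l < p \<or> p + length \<phi> \<le> q + l \<longrightarrow>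
        (\<forall>y\<in>set m. m' ! l < y) \<or> (\<forall>y\<in>set m. y < m' ! l);
      \<forall>k<length \<phi>. p + k < q \<or> q + length \<psi> \<le> p + k \<longrightarrow>
        (\<forall>y\<in>set m'. m ! k < y) \<or> (\<forall>y\<in>set m'. y < m ! k)\<rbrakk> \<Longrightarrow> False"
  shows "\<exists>F m m'. two_slots F m m' \<and> F m m' = xs \<and> order_iso \<phi> m \<and> order_iso \<psi> m'"
proof -
  obtain s m t where m: "xs = s @ m @ t" "order_iso \<phi> m" "block_in s m t"
    using \<phi> by (auto simp: interval_copy_def)
  obtain s' m' t' where m': "xs = s' @ m' @ t'" "order_iso \<psi> m'" "block_in s' m' t'"
    using \<psi> by (auto simp: interval_copy_def)
  have len: "length \<phi> = length m" "length \<psi> = length m'"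
    using m(2) m'(2) by (simp_all add: order_iso_def)
  have nth: "xs ! (length s + k) = m ! k" if "k < length m" for k
    unfolding m(1) using that by (simp add: nth_append)
  have nth': "xs ! (length s' + k) = m' ! k" if "k < length m'" for k
    unfolding m'(1) using that by (simp add: nth_append)
  have out: "(\<forall>y\<in>set m. xs ! i < y) \<or> (\<forall>y\<in>set m. y < xs ! i)"
    if "i < length xs" "i < length s \<or> length s + length m \<le> i"
      "xs = s @ m @ t" "block_in s m t" for i s m t
  proof -
    have "xs ! i \<in> set s \<union> set t"
      using that(1,2) unfolding that(3) by (auto simp: nth_append)
    then show ?thesis using that(4) unfolding block_in_def by blast
  qed
  have "length s + length m \<le> length s' \<or> length s' + length m' \<le> length s"
  proof (rule ccontr)
    assume neg: "\<not> ?thesis"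
    show False
    proof (rule clash[of m m' "length s'" "length s"])
      show "\<forall>l<length \<psi>. length s' + l < length s \<or> length s + length \<phi> \<le> length s' + l \<longrightarrow>
        (\<forall>y\<in>set m. m' ! l < y) \<or> (\<forall>y\<in>set m. y < m' ! l)"
      proof (intro allI impI)
        fix l assume "l < length \<psi>" "length s' + l < length s \<or> length s + length \<phi> \<le> length s' + l"
        then show "(\<forall>y\<in>set m. m' ! l < y) \<or> (\<forall>y\<in>set m. y < m' ! l)"
          using out[OF _ _ m(1,3), of "length s' + l"] nth'[of l] len by (simp add: m'(1))
      qed
      show "\<forall>k<length \<phi>. length s + k < length s' \<or> length s' + length \<psi> \<le> length s + k \<longrightarrow>
        (\<forall>y\<in>set m'. m ! k < y) \<or> (\<forall>y\<in>set m'. y < m ! k)"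
      proof (intro allI impI)
        fix k assume "k < length \<phi>" "length s + k < length s' \<or> length s' + length \<psi> \<le> length s + k"
        then show "(\<forall>y\<in>set m'. m ! k < y) \<or> (\<forall>y\<in>set m'. y < m ! k)"
          using out[OF _ _ m'(1,3), of "length s + k"] nth[of k] len by (simp add: m(1))
      qed
      show "\<forall>k<length \<phi>. \<forall>l<length \<psi>. length s + k = length s' + l \<longrightarrow> m ! k = m' ! l"
        using nth nth' len by metis
    qed (use m(2) m'(2) neg len in auto)
  qed
  then show ?thesis
    using two_slots_exist[OF m(1,3) m'(1,3)] m(2) m'(2) by blast
qed

lemma order_iso_12: "order_iso [1, 2] m \<longleftrightarrow> (\<exists>x y. m = [x, y] \<and> x < y)"
  by (auto simp: order_iso_Cons order_iso_Nil)

lemma order_iso_21: "order_iso [2, 1] m \<longleftrightarrow> (\<exists>x y. m = [x, y] \<and> y < x)"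
  by (auto simp: order_iso_Cons order_iso_Nil)

lemma order_iso_213: "order_iso [2, 1, 3] m \<longleftrightarrow> (\<exists>x y z. m = [x, y, z] \<and> y < x \<and> x < z)"
  by (auto simp: order_iso_Cons order_iso_Nil)

lemma order_iso_321: "order_iso [3, 2, 1] m \<longleftrightarrow> (\<exists>x y z. m = [x, y, z] \<and> z < y \<and> y < x)"
  by (auto simp: order_iso_Cons order_iso_Nil)

lemma order_iso_2431:
  "order_iso [2, 4, 3, 1] m \<longleftrightarrow> (\<exists>w x y z. m = [w, x, y, z] \<and> z < w \<and> w < y \<and> y < x)"
proof -
  have "order_iso [2, 4, 3, 1] [w, x, y, z] \<longleftrightarrow> z < w \<and> w < y \<and> y < x" for w x y z
    by (auto simp: order_iso_Cons order_iso_Nil)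
  moreover have "\<exists>w x y z. m = [w, x, y, z]" if "order_iso [2, 4, 3, 1] m"
    using that unfolding order_iso_Cons order_iso_Nil by blast
  ultimately show ?thesis by blast
qed

lemma disjoint_12_21:
  assumes "interval_copy [1, 2] xs" "interval_copy [2, 1] xs"
  shows "\<exists>F m m'. two_slots F m m' \<and> F m m' = xs \<and> order_iso [1, 2] m \<and> order_iso [2, 1] m'"
proof (rule disjoint_interval_copies[OF assms], goal_cases)
  case (1 p q m m')
  obtain x y where m: "m = [x, y]" "x < y"
    using 1(1) unfolding order_iso_12 by blast
  obtain x' y' where m': "m' = [x', y']" "y' < x'"
    using 1(2) unfolding order_iso_21 by blast
  consider "p = q" | "p = q + 1" | "q = p + 1" using 1(3,4) by force
  then show False
    by cases (use 1(3-) m m' in \<open>auto simp: All_less_Suc eval_nat_numeral\<close>)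
qed

lemma disjoint_213_321:
  assumes "interval_copy [2, 1, 3] xs" "interval_copy [3, 2, 1] xs"
  shows "\<exists>F m m'. two_slots F m m' \<and> F m m' = xs \<and> order_iso [2, 1, 3] m \<and> order_iso [3, 2, 1] m'"
proof (rule disjoint_interval_copies[OF assms], goal_cases)
  case (1 p q m m')
  obtain x y z where m: "m = [x, y, z]" "y < x" "x < z"
    using 1(1) unfolding order_iso_213 by blast
  obtain x' y' z' where m': "m' = [x', y', z']" "z' < y'" "y' < x'"
    using 1(2) unfolding order_iso_321 by blast
  consider "p = q" | "p = q + 1" | "p = q + 2" | "q = p + 1" | "q = p + 2" using 1(3,4) by force
  then show False
    by cases (use 1(3-) m m' in \<open>auto simp: All_less_Suc eval_nat_numeral\<close>)
qed

lemma disjoint_213_2431: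
  assumes "interval_copy [2, 1, 3] xs" "interval_copy [2, 4, 3, 1] xs"
  shows "\<exists>F m m'. two_slots F m m' \<and> F m m' = xs \<and> order_iso [2, 1, 3] m \<and> order_iso [2, 4, 3, 1] m'"
proof (rule disjoint_interval_copies[OF assms], goal_cases)
  case (1 p q m m')
  obtain x y z where m: "m = [x, y, z]" "y < x" "x < z"
    using 1(1) unfolding order_iso_213 by blast
  obtain w' x' y' z' where m': "m' = [w', x', y', z']" "z' < w'" "w' < y'" "y' < x'"
    using 1(2) unfolding order_iso_2431 by blast
  consider "p = q" | "p = q + 1" | "p = q + 2" | "p = q + 3" | "q = p + 1" | "q = p + 2"
    using 1(3,4) by force
  then show False
    by cases (use 1(3-) m m' in \<open>auto simp: All_less_Suc eval_nat_numeral\<close>)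
qed

lemma interval_copy_imp:
  "interval_copy [2, 1, 3] xs \<Longrightarrow> interval_copy [2, 1] xs"
  "interval_copy [3, 2, 1] xs \<Longrightarrow> interval_copy [2, 1] xs"
  "interval_copy [2, 3, 1] xs \<Longrightarrow> interval_copy [1, 2] xs"
  "interval_copy [2, 4, 3, 1] xs \<Longrightarrow> interval_copy [2, 1] xs"
  using interval_copy_sub[of "[]" "[2, 1]" "[3]" xs] interval_copy_sub[of "[3]" "[2, 1]" "[]" xs]
    interval_copy_cong[OF interval_copy_sub[of "[]" "[2, 3]" "[1]" xs], of "[1, 2]"]
    interval_copy_cong[OF interval_copy_sub[of "[2]" "[4, 3]" "[1]" xs], of "[2, 1]"]
  by (simp_all add: block_in_def order_iso_Cons order_iso_Nil)

lemma contained_delete_iff: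
  assumes "block_in s m t" "order_iso \<phi> m" "\<not> interval_copy \<phi> \<rho>"
  shows "contained \<rho> (s @ m @ t) \<longleftrightarrow> (\<exists>d\<in>set (deletions m). contained \<rho> (s @ d @ t))"
proof
  assume "contained \<rho> (s @ m @ t)"
  then show "\<exists>d\<in>set (deletions m). contained \<rho> (s @ d @ t)"
    using contained_block_cases[OF _ assms(1)] interval_copy_cong assms(2,3) by blast
next
  assume "\<exists>d\<in>set (deletions m). contained \<rho> (s @ d @ t)"
  then show "contained \<rho> (s @ m @ t)"
    using subseq_deletions by (fastforce intro: contained_mono list_emb_append_mono)
qed

lemma contained_sub_block_cong:
  assumes "block_in s m t" "set a \<subseteq> set m" "set b \<subseteq> set m" "order_iso a b"
  shows "contained \<rho> (s @ a @ t) \<longleftrightarrow> contained \<rho> (s @ b @ t)"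
  using order_iso_sub_block[OF assms] contained_order_iso order_iso_sym by blast

lemma contained_delete_pair:
  assumes "block_in s [x, y] t" "order_iso \<phi> [x, y]" "\<not> interval_copy \<phi> \<rho>"
  shows "contained \<rho> (s @ x # y # t) \<longleftrightarrow> contained \<rho> (s @ x # t)"
proof -
  have "contained \<rho> (s @ [y] @ t) \<longleftrightarrow> contained \<rho> (s @ [x] @ t)"
    by (rule contained_sub_block_cong[OF assms(1)]) (auto simp: order_iso_Cons order_iso_Nil)
  then show ?thesis
    using contained_delete_iff[OF assms] by auto
qed

lemma cancel_12:
  assumes blk: "block_in s [x, y] t" and xy: "x < y" and no: "\<not> interval_copy [1, 2] \<rho>"
  shows "(\<Sum>(c, a) \<leftarrow> [(1, [x, y]), (-1, [x])]. c * of_bool (contained \<rho> (s @ a @ t))) = (0 :: int)"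
  using contained_delete_pair[OF blk _ no] xy order_iso_12[of "[x, y]"] by simp

lemma cancel_21:
  assumes blk: "block_in s [x, y] t" and xy: "y < x" and no: "\<not> interval_copy [2, 1] \<rho>"
  shows "(\<Sum>(c, a) \<leftarrow> [(1, [x, y]), (-1, [x])]. c * of_bool (contained \<rho> (s @ a @ t))) = (0 :: int)"
  using contained_delete_pair[OF blk _ no] xy order_iso_21[of "[x, y]"] by simp

lemma contained_block_mono:
  "contained \<rho> (s @ a @ t) \<Longrightarrow> subseq a b \<Longrightarrow> contained \<rho> (s @ b @ t)"
  by (fastforce intro: contained_mono list_emb_append_mono)

lemma cancel_213:
  assumes blk: "block_in s [x, y, z] t" and xyz: "y < x" "x < z"
    and no: "\<not> interval_copy [2, 1, 3] \<rho>"
    and adj: "\<not> (interval_copy [1, 2] \<rho> \<and> interval_copy [2, 1] \<rho>)"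
  shows "(\<Sum>(c, a) \<leftarrow> [(1, [x, y, z]), (-1, [x, z]), (-1, [x, y]), (1, [x])].
      c * of_bool (contained \<rho> (s @ a @ t))) = (0 :: int)"
proof -
  let ?P = "\<lambda>a. contained \<rho> (s @ a @ t)"
  have "?P [x, y, z] \<longleftrightarrow> ?P [y, z] \<or> ?P [x, z] \<or> ?P [x, y]"
    using contained_delete_iff[OF blk _ no] xyz order_iso_213[of "[x, y, z]"] by simp
  moreover have "?P [y, z] \<longleftrightarrow> ?P [x, z]"
    by (rule contained_sub_block_cong[OF blk]) (use xyz in \<open>auto simp: order_iso_Cons order_iso_Nil\<close>)
  moreover have "?P [x, z] \<longleftrightarrow> ?P [x]" if "\<not> interval_copy [1, 2] \<rho>"
    using contained_delete_pair[OF block_in_subset[OF blk, of s "[x, z]" t] _ that]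
      xyz order_iso_12[of "[x, z]"] by simp
  moreover have "?P [x, y] \<longleftrightarrow> ?P [x]" if "\<not> interval_copy [2, 1] \<rho>"
    using contained_delete_pair[OF block_in_subset[OF blk, of s "[x, y]" t] _ that]
      xyz order_iso_21[of "[x, y]"] by simp
  moreover have "?P [x] \<Longrightarrow> ?P [x, y]" "?P [x] \<Longrightarrow> ?P [x, z]"
    using contained_block_mono[of \<rho> s "[x]" t "[x, y]"] contained_block_mono[of \<rho> s "[x]" t "[x, z]"]
    by simp_all
  ultimately show ?thesis using adj by (auto simp del: append_Cons append_Nil)
qed

lemma contained_321_iff:
  assumes blk: "block_in s [x, y, z] t" and xyz: "z < y" "y < x"
    and no: "\<not> interval_copy [3, 2, 1] \<rho>"
  shows "contained \<rho> (s @ [x, y, z] @ t) \<longleftrightarrow> contained \<rho> (s @ [x, y] @ t)"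
proof -
  let ?P = "\<lambda>a. contained \<rho> (s @ a @ t)"
  have "?P [x, y, z] \<longleftrightarrow> ?P [y, z] \<or> ?P [x, z] \<or> ?P [x, y]"
    using contained_delete_iff[OF blk _ no] xyz order_iso_321[of "[x, y, z]"] by simp
  moreover have "?P [y, z] \<longleftrightarrow> ?P [x, y]"
    by (rule contained_sub_block_cong[OF blk]) (use xyz in \<open>auto simp: order_iso_Cons order_iso_Nil\<close>)
  moreover have "?P [x, z] \<longleftrightarrow> ?P [x, y]"
    by (rule contained_sub_block_cong[OF blk]) (use xyz in \<open>auto simp: order_iso_Cons order_iso_Nil\<close>)
  ultimately show ?thesis by blast
qed

text \<open>The weights are the values \<open>\<mu>[\<beta>, 2431]\<close> for the nonempty patterns \<open>\<beta>\<close> of \<open>2431\<close>, in the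
  order \<open>2431, 132, 231, 321, 21, 12, 1\<close>.\<close>

lemma cancel_2431:
  assumes blk: "block_in s [w, x, y, z] t" and wxyz: "z < w" "w < y" "y < x"
    and no: "\<not> interval_copy [2, 4, 3, 1] \<rho>" "\<not> interval_copy [3, 2, 1] \<rho>" "\<not> interval_copy [1, 2] \<rho>"
  shows "(\<Sum>(c, a) \<leftarrow> [(1, [w, x, y, z]), (-1, [w, x, y]), (-1, [w, x, z]), (-1, [x, y, z]),
        (2, [x, y]), (1, [w, x]), (-1, [w])].
      c * of_bool (contained \<rho> (s @ a @ t))) = (0 :: int)"
proof -
  let ?P = "\<lambda>a. contained \<rho> (s @ a @ t)"
  have cong: "?P a \<longleftrightarrow> ?P b" if "set a \<subseteq> {w, x, y, z}" "set b \<subseteq> {w, x, y, z}" "order_iso a b" for a b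
    using contained_sub_block_cong[OF blk] that by simp
  have no231: "\<not> interval_copy [2, 3, 1] \<rho>"
    using interval_copy_imp no(3) by blast
  have "?P [w, x, y, z] \<longleftrightarrow> ?P [x, y, z] \<or> ?P [w, y, z] \<or> ?P [w, x, z] \<or> ?P [w, x, y]"
    using contained_delete_iff[OF blk _ no(1)] wxyz order_iso_2431[of "[w, x, y, z]"] by simp
  moreover have "?P [w, y, z] \<longleftrightarrow> ?P [w, x, z]"
    by (rule cong) (use wxyz in \<open>auto simp: order_iso_Cons order_iso_Nil\<close>)
  moreover have "?P [x, y, z] \<longleftrightarrow> ?P [x, y]"
    using contained_321_iff[OF block_in_subset[OF blk, of s "[x, y, z]" t]] wxyz no(2) by simp
  moreover have "?P [w, x] \<longleftrightarrow> ?P [w]"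
    using contained_delete_pair[OF block_in_subset[OF blk, of s "[w, x]" t] _ no(3)]
      wxyz order_iso_12[of "[w, x]"] by simp
  moreover have "?P [w, x, z] \<longleftrightarrow> ?P [x, y]"
  proof -
    have "?P [w, x, z] \<longleftrightarrow> ?P [x, z] \<or> ?P [w, z] \<or> ?P [w, x]"
      using contained_delete_iff[OF block_in_subset[OF blk, of s "[w, x, z]" t] _ no231]
        wxyz by (simp add: order_iso_Cons order_iso_Nil)
    moreover have "?P [x, z] \<longleftrightarrow> ?P [x, y]" "?P [w, z] \<longleftrightarrow> ?P [x, y]"
      by (rule cong; use wxyz in \<open>auto simp: order_iso_Cons order_iso_Nil\<close>)+
    moreover have "?P [w] \<Longrightarrow> ?P [w, z]"
      using contained_block_mono[of \<rho> s "[w]" t "[w, z]"] by simp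
    ultimately show ?thesis using \<open>?P [w, x] \<longleftrightarrow> ?P [w]\<close> by blast
  qed
  moreover have "?P [x, y] \<Longrightarrow> ?P [w, x, y]"
    using contained_block_mono[of \<rho> s "[x, y]" t "[w, x, y]"] by simp
  ultimately show ?thesis by (auto simp del: append_Cons append_Nil)
qed

lemma mu_eq_0_12_21:
  assumes "is_perm \<pi>" "interval_copy [1, 2] \<pi>" "interval_copy [2, 1] \<pi>"
  shows "mu [1] \<pi> = 0"
  using assms
proof (induction "length \<pi>" arbitrary: \<pi> rule: less_induct)
  case less
  obtain F m m' where F: "two_slots F m m'" "F m m' = \<pi>" "order_iso [1, 2] m" "order_iso [2, 1] m'"
    using disjoint_12_21 less.prems(2,3) by blast
  obtain x y where m: "m = [x, y]" "x < y" using F(3) unfolding order_iso_12 by blast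
  obtain x' y' where m': "m' = [x', y']" "y' < x'" using F(4) unfolding order_iso_21 by blast
  have "mu [1] (F m m') = 0"
  proof (rule mu_eq_0_by_weights[OF F(1), where as = "[(-1, [x])]" and bs = "[(-1, [x'])]"])
    fix \<rho> assume \<rho>: "is_perm \<rho>" "length \<rho> < length (F m m')" "mu [1] \<rho> \<noteq> 0"
    then consider "\<not> interval_copy [1, 2] \<rho>" | "\<not> interval_copy [2, 1] \<rho>"
      using less.hyps F(2) by blast
    then show "(\<forall>b. subseq b m' \<longrightarrow>
        (\<Sum>(c, a) \<leftarrow> (1, m) # [(-1, [x])]. c * of_bool (contained \<rho> (F a b))) = (0 :: int)) \<or>
      (\<forall>a. subseq a m \<longrightarrow>
        (\<Sum>(c, b) \<leftarrow> (1, m') # [(-1, [x'])]. c * of_bool (contained \<rho> (F a b))) = (0 :: int))"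
    proof cases
      case 1
      show ?thesis
      proof (intro disjI1 allI impI)
        fix b assume "subseq b m'"
        then obtain s t where "\<And>a. F a b = s @ a @ t" "block_in s m t"
          using F(1) unfolding two_slots_def by blast
        then show "(\<Sum>(c, a) \<leftarrow> (1, m) # [(-1, [x])]. c * of_bool (contained \<rho> (F a b))) = (0 :: int)"
          unfolding m(1) using cancel_12[OF _ m(2) 1] by presburger
      qed
    next
      case 2
      show ?thesis
      proof (intro disjI2 allI impI)
        fix a assume "subseq a m"
        then obtain s t where "\<And>b. F a b = s @ b @ t" "block_in s m' t"
          using F(1) unfolding two_slots_def by blast
        then show "(\<Sum>(c, b) \<leftarrow> (1, m') # [(-1, [x'])]. c * of_bool (contained \<rho> (F a b))) = (0 :: int)"
          unfolding m'(1) using cancel_21[OF _ m'(2) 2] by presburger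
      qed
    qed
  qed (use less.prems F(2) m m' in auto)
  then show ?case using F(2) by simp
qed

lemma mu_eq_0_213_321:
  assumes "is_perm \<pi>" "interval_copy [2, 1, 3] \<pi>" "interval_copy [3, 2, 1] \<pi>"
  shows "mu [1] \<pi> = 0"
  using assms
proof (induction "length \<pi>" arbitrary: \<pi> rule: less_induct)
  case less
  obtain F m m' where F: "two_slots F m m'" "F m m' = \<pi>" "order_iso [2, 1, 3] m" "order_iso [3, 2, 1] m'"
    using disjoint_213_321 less.prems(2,3) by blast
  obtain x y z where m: "m = [x, y, z]" "y < x" "x < z"
    using F(3) unfolding order_iso_213 by blast
  obtain x' y' z' where m': "m' = [x', y', z']" "z' < y'" "y' < x'"
    using F(4) unfolding order_iso_321 by blast
  let ?as = "[(-1, [x, z]), (-1, [x, y]), (1, [x])] :: (int \<times> nat list) list"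
  let ?bs = "[(-1, [x', y'])] :: (int \<times> nat list) list"
  have "mu [1] (F m m') = 0"
  proof (rule mu_eq_0_by_weights[OF F(1), where as = ?as and bs = ?bs])
    fix \<rho> assume \<rho>: "is_perm \<rho>" "length \<rho> < length (F m m')" "mu [1] \<rho> \<noteq> 0"
    then have adj: "\<not> (interval_copy [1, 2] \<rho> \<and> interval_copy [2, 1] \<rho>)"
      using mu_eq_0_12_21 by blast
    consider "\<not> interval_copy [2, 1, 3] \<rho>" | "\<not> interval_copy [3, 2, 1] \<rho>"
      using less.hyps F(2) \<rho> by blast
    then show "(\<forall>b. subseq b m' \<longrightarrow>
        (\<Sum>(c, a) \<leftarrow> (1, m) # ?as. c * of_bool (contained \<rho> (F a b))) = 0) \<or>
      (\<forall>a. subseq a m \<longrightarrow>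
        (\<Sum>(c, b) \<leftarrow> (1, m') # ?bs. c * of_bool (contained \<rho> (F a b))) = 0)"
    proof cases
      case 1
      show ?thesis
      proof (intro disjI1 allI impI)
        fix b assume "subseq b m'"
        then obtain s t where "\<And>a. F a b = s @ a @ t" "block_in s m t"
          using F(1) unfolding two_slots_def by blast
        then show "(\<Sum>(c, a) \<leftarrow> (1, m) # ?as. c * of_bool (contained \<rho> (F a b))) = 0"
          unfolding m(1) using cancel_213[OF _ m(2,3) 1 adj] by presburger
      qed
    next
      case 2
      show ?thesis
      proof (intro disjI2 allI impI)
        fix a assume "subseq a m"
        then obtain s t where "\<And>b. F a b = s @ b @ t" "block_in s m' t"
          using F(1) unfolding two_slots_def by blast
        then show "(\<Sum>(c, b) \<leftarrow> (1, m') # ?bs. c * of_bool (contained \<rho> (F a b))) = 0"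
          unfolding m'(1) using contained_321_iff[OF _ m'(2,3) 2] by simp
      qed
    qed
  qed (use less.prems F(2) m m' in auto)
  then show ?case using F(2) by simp
qed

lemma mu_eq_0_213_2431:
  assumes "is_perm \<pi>" "interval_copy [2, 1, 3] \<pi>" "interval_copy [2, 4, 3, 1] \<pi>"
  shows "mu [1] \<pi> = 0"
  using assms
proof (induction "length \<pi>" arbitrary: \<pi> rule: less_induct)
  case less
  obtain F m m' where F: "two_slots F m m'" "F m m' = \<pi>"
      "order_iso [2, 1, 3] m" "order_iso [2, 4, 3, 1] m'"
    using disjoint_213_2431 less.prems(2,3) by blast
  obtain x y z where m: "m = [x, y, z]" "y < x" "x < z"
    using F(3) unfolding order_iso_213 by blast
  obtain w' x' y' z' where m': "m' = [w', x', y', z']" "z' < w'" "w' < y'" "y' < x'"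
    using F(4) unfolding order_iso_2431 by blast
  let ?as = "[(-1, [x, z]), (-1, [x, y]), (1, [x])] :: (int \<times> nat list) list"
  let ?bs = "[(-1, [w', x', y']), (-1, [w', x', z']), (-1, [x', y', z']),
    (2, [x', y']), (1, [w', x']), (-1, [w'])] :: (int \<times> nat list) list"
  have "mu [1] (F m m') = 0"
  proof (rule mu_eq_0_by_weights[OF F(1), where as = ?as and bs = ?bs])
    fix \<rho> assume \<rho>: "is_perm \<rho>" "length \<rho> < length (F m m')" "mu [1] \<rho> \<noteq> 0"
    then have adj: "\<not> (interval_copy [1, 2] \<rho> \<and> interval_copy [2, 1] \<rho>)"
      using mu_eq_0_12_21 by blast
    show "(\<forall>b. subseq b m' \<longrightarrow>
        (\<Sum>(c, a) \<leftarrow> (1, m) # ?as. c * of_bool (contained \<rho> (F a b))) = 0) \<or>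
      (\<forall>a. subseq a m \<longrightarrow>
        (\<Sum>(c, b) \<leftarrow> (1, m') # ?bs. c * of_bool (contained \<rho> (F a b))) = 0)"
    proof (cases "interval_copy [2, 1, 3] \<rho>")
      case False
      show ?thesis
      proof (intro disjI1 allI impI)
        fix b assume "subseq b m'"
        then obtain s t where "\<And>a. F a b = s @ a @ t" "block_in s m t"
          using F(1) unfolding two_slots_def by blast
        then show "(\<Sum>(c, a) \<leftarrow> (1, m) # ?as. c * of_bool (contained \<rho> (F a b))) = 0"
          unfolding m(1) using cancel_213[OF _ m(2,3) False adj] by presburger
      qed
    next
      case True
      then have no: "\<not> interval_copy [2, 4, 3, 1] \<rho>" "\<not> interval_copy [3, 2, 1] \<rho>"
          "\<not> interval_copy [1, 2] \<rho>"
        using less.hyps F(2) \<rho> mu_eq_0_213_321 interval_copy_imp(1) adj by blast+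
      show ?thesis
      proof (intro disjI2 allI impI)
        fix a assume "subseq a m"
        then obtain s t where "\<And>b. F a b = s @ b @ t" "block_in s m' t"
          using F(1) unfolding two_slots_def by blast
        then show "(\<Sum>(c, b) \<leftarrow> (1, m') # ?bs. c * of_bool (contained \<rho> (F a b))) = 0"
          unfolding m'(1) using cancel_2431[OF _ m'(2-4) no] by presburger
      qed
    qed
  qed (use less.prems F(2) m m' in auto)
  then show ?case using F(2) by simp
qed

lemma interval_copy_inflation:
  assumes \<tau>: "is_perm \<tau>" and B: "\<And>k. k < length \<tau> \<Longrightarrow> is_perm (B k)" and i: "i < length \<tau>"
  shows "interval_copy (B i) (inflation \<tau> B)"
proof -
  let ?b = "\<lambda>k. map (\<lambda>v. block_offset \<tau> B k + v) (B k)"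
  let ?s = "concat (map ?b [0..<i])" and ?t = "concat (map ?b [Suc i..<length \<tau>])"
  have "[0..<length \<tau>] = [0..<i] @ i # [Suc i..<length \<tau>]"
    using upt_add_eq_append[of 0 i "length \<tau> - i"] i by (simp add: upt_conv_Cons)
  then have "inflation \<tau> B = ?s @ ?b i @ ?t" by (simp add: inflation_def)
  moreover have "order_iso (B i) (?b i)"
    by (rule order_iso_map) (simp add: strict_mono_on_def)
  moreover have "block_in ?s (?b i) ?t"
    unfolding block_in_def
  proof
    fix x assume "x \<in> set ?s \<union> set ?t"
    moreover have "set ?s \<union> set ?t = (\<Union>k\<in>{0..<i} \<union> {Suc i..<length \<tau>}. set (?b k))"
      by (simp add: UN_Un)
    ultimately obtain k where "k \<in> {0..<i} \<union> {Suc i..<length \<tau>}" "x \<in> set (?b k)" by blast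
    then have k: "k < length \<tau>" "k \<noteq> i" "x \<in> set (?b k)" using i by auto
    have bound: "block_offset \<tau> B k < v \<and> v \<le> block_offset \<tau> B k + length (B k)"
      if "k < length \<tau>" "v \<in> set (?b k)" for k v
      using that is_permD(1)[OF B[OF that(1)]] by auto
    have "\<tau> ! k < \<tau> ! i \<or> \<tau> ! i < \<tau> ! k"
      using is_permD(2)[OF \<tau>] k i by (auto simp: nth_eq_iff_index_eq neq_iff[symmetric])
    then show "(\<forall>y\<in>set (?b i). x < y) \<or> (\<forall>y\<in>set (?b i). y < x)"
    proof
      assume "\<tau> ! k < \<tau> ! i"
      from block_offset_less[OF k(1) this, of B] have "\<forall>y\<in>set (?b i). x < y"
        using bound[OF k(1,3)] bound[OF i] by fastforce
      then show ?thesis ..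
    next
      assume "\<tau> ! i < \<tau> ! k"
      from block_offset_less[OF i this, of B] have "\<forall>y\<in>set (?b i). y < x"
        using bound[OF k(1,3)] bound[OF i] by fastforce
      then show ?thesis ..
    qed
  qed
  ultimately show ?thesis unfolding interval_copy_def by blast
qed

theorem theorem6p1:
  shows "annihilator_pair [2, 1, 3] [2, 4, 3, 1]"
  unfolding annihilator_pair_def
proof (intro conjI allI impI)
  show perm: "is_perm [2, 1, 3]" "is_perm [2, 4, 3, 1]"
    by (auto intro!: is_permI)
  have perm1: "is_perm [1]" by (auto intro: is_permI)
  fix \<tau> :: "nat list" and i j
  assume *: "is_perm \<tau> \<and> i < length \<tau> \<and> j < length \<tau> \<and> i \<noteq> j"
  let ?B = "\<lambda>k. if k = i then [2, 1, 3] else if k = j then [2, 4, 3, 1] else [1 :: nat]"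
  have B: "is_perm (?B k)" for k using perm perm1 by simp
  show "mu [1] (inflation2 \<tau> i j [2, 1, 3] [2, 4, 3, 1]) = 0"
    unfolding inflation2_def
  proof (rule mu_eq_0_213_2431)
    show "is_perm (inflation \<tau> ?B)" using * by (intro is_perm_inflation B) simp
    show "interval_copy [2, 1, 3] (inflation \<tau> ?B)"
      using interval_copy_inflation[of \<tau> ?B i, OF _ B] * by simp
    show "interval_copy [2, 4, 3, 1] (inflation \<tau> ?B)"
      using interval_copy_inflation[of \<tau> ?B j, OF _ B] * by simp
  qed
qed simp_all

end
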